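(* Let $P:\mathbb{R}^n\to\mathbb{R}^n$ be a self-adjoint nonexpansive linear operator, let $q\in\mathbb{R}^n$, let $f_1(x)=\tfrac12\langle Px,x\rangle+\langle q,x\rangle$ and $S_1x=\nabla f_1(x)=Px+q$. Let $f_2:\mathbb{R}^n\to\mathbb{R}$ be differentiable with $S_2=\nabla f_2$ nonexpansive. Let $F(x)=\tfrac12\langle Px,x\rangle-f_2(\nabla f_1(x))$, let $X^\star=\{x\in\mathbb{R}^n:\nabla F(x)=0\}$, and let $\mathrm{fix}(S_2S_1)=\{x\in\mathbb{R}^n: S_2S_1x=x\}$. If $P$ is nonsingular, then $X^\star=\mathrm{fix}(S_2S_1)$. If in addition $P$ is positive definite, then $\operatorname{Argmin}_xF(x)=X^\star=\mathrm{fix}(S_2S_1)$.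
   Context: $\langle\cdot,\cdot\rangle$ is an inner product on $\mathbb{R}^n$ with induced norm $\|\cdot\|$; gradients and adjoints are taken with respect to it. A mapping $T:\mathbb{R}^n\to\mathbb{R}^n$ is nonexpansive if $\|Tx-Ty\|\le\|x-y\|$ for all $x,y$. $S_2S_1$ is the composition $x\mapsto S_2(S_1x)$. A linear operator is positive definite if it is self-adjoint with all eigenvalues positive. $\operatorname{Argmin}_xF(x)$ denotes the (possibly empty) set of global minimizers of $F$ over $\mathbb{R}^n$. *)

theory Defs
  imports "HOL-Analysis.Analysis"
begin

(* The inner product is an explicit parameter ip, since it need not be the standard
   inner product of the type class real_inner.  The library's norm on real ^ 'n enters only
   through has_derivative, where the choice of norm is irrelevant in finite dimension. *)

definition inner_product :: "('v::real_vector \<Rightarrow> 'v \<Rightarrow> real) \<Rightarrow> bool" where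
  "inner_product ip \<longleftrightarrow>
     bilinear ip \<and> (\<forall>x y. ip x y = ip y x) \<and> (\<forall>x. x \<noteq> 0 \<longrightarrow> ip x x > 0)"

definition ip_norm :: "('v::real_vector \<Rightarrow> 'v \<Rightarrow> real) \<Rightarrow> 'v \<Rightarrow> real" where
  "ip_norm ip x = sqrt (ip x x)"

definition nonexpansive ::
  "('v::real_vector \<Rightarrow> 'v \<Rightarrow> real) \<Rightarrow> ('v \<Rightarrow> 'v) \<Rightarrow> bool" where
  "nonexpansive ip T \<longleftrightarrow> (\<forall>x y. ip_norm ip (T x - T y) \<le> ip_norm ip (x - y))"

(* f is differentiable at x and its gradient there is g.  For an inner product ip such a g is
   unique; it exists if and only if f is differentiable at x (in finite dimension). *)
definition has_gradient ::
  "('v::real_normed_vector \<Rightarrow> 'v \<Rightarrow> real) \<Rightarrow> ('v \<Rightarrow> real) \<Rightarrow> 'v \<Rightarrow> 'v \<Rightarrow> bool" where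
  "has_gradient ip f g x \<longleftrightarrow> (f has_derivative (\<lambda>h. ip g h)) (at x)"

definition self_adjoint ::
  "('v::real_vector \<Rightarrow> 'v \<Rightarrow> real) \<Rightarrow> ('v \<Rightarrow> 'v) \<Rightarrow> bool" where
  "self_adjoint ip A \<longleftrightarrow> linear A \<and> (\<forall>x y. ip (A x) y = ip x (A y))"

definition is_eigenvalue :: "('v::real_vector \<Rightarrow> 'v) \<Rightarrow> real \<Rightarrow> bool" where
  "is_eigenvalue A c \<longleftrightarrow> (\<exists>v. v \<noteq> 0 \<and> A v = c *\<^sub>R v)"

(* Real eigenvalues suffice: a self-adjoint operator has no others. *)
definition positive_definite ::
  "('v::real_vector \<Rightarrow> 'v \<Rightarrow> real) \<Rightarrow> ('v \<Rightarrow> 'v) \<Rightarrow> bool" where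
  "positive_definite ip A \<longleftrightarrow> self_adjoint ip A \<and> (\<forall>c. is_eigenvalue A c \<longrightarrow> c > 0)"

definition Argmin :: "('v \<Rightarrow> real) \<Rightarrow> 'v set" where
  "Argmin F = {x. is_arg_min F (\<lambda>_. True) x}"

definition fixed_points :: "('v \<Rightarrow> 'v) \<Rightarrow> 'v set" where
  "fixed_points T = {x. T x = x}"

end

theory Submission
  imports Defs
begin

text \<open>By the chain rule and self-adjointness, \<open>\<nabla>F(x) = P (x - S\<^sub>2 S\<^sub>1 x)\<close>, so for nonsingular \<open>P\<close> the
  critical points are the fixed points. If \<open>P\<close> is positive definite, then the smallest Rayleigh
  quotient is an eigenvalue, so \<open>\<langle>P x, x\<rangle> \<ge> 0\<close>, and the Cauchy-Schwarz inequality for the form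
  \<open>\<langle>P x, y\<rangle>\<close> together with nonexpansiveness gives \<open>\<parallel>P u\<parallel>\<^sup>2 \<le> \<langle>P u, u\<rangle>\<close>. Since
  \<open>\<langle>S\<^sub>2 S\<^sub>1 x - S\<^sub>2 S\<^sub>1 y, P (x - y)\<rangle> \<le> \<parallel>P (x - y)\<parallel>\<^sup>2\<close>, the gradient of \<open>F\<close> is monotone, and every
  critical point is a global minimizer.\<close>

section \<open>Semidefinite forms and inner products\<close>

text \<open>Nonnegativity of \<open>b\<close> at \<open>s x - t y\<close> gives a quadratic form in
  \<open>s\<close> and \<open>t\<close>. Definiteness is not assumed because the lemma is also
  applied to forms that may have nonzero null vectors.\<close>

lemma bilinear_semidefinite_Cauchy_Schwarz:
  fixes b :: "'v::real_vector \<Rightarrow> 'v \<Rightarrow> real"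
  assumes b: "bilinear b" and sym: "\<And>x y. b x y = b y x" and nonneg: "\<And>x. 0 \<le> b x x"
  shows "(b x y)\<^sup>2 \<le> b x x * b y y"
proof -
  have quad: "0 \<le> s\<^sup>2 * b x x - 2 * s * t * b x y + t\<^sup>2 * b y y" for s t
    using nonneg[of "s *\<^sub>R x - t *\<^sub>R y"] sym[of y x]
    by (simp add: bilinear_lsub[OF b] bilinear_rsub[OF b] bilinear_lmul[OF b] bilinear_rmul[OF b]
        power2_eq_square algebra_simps)
  show ?thesis
  proof (cases "b y y = 0")
    case True
    have "0 \<le> b x x - 2 * (t * b x y)" for t
      using quad[of 1 t] True by simp
    \<comment> \<open>If \<open>b x y\<close> were nonzero, this \<open>t\<close> would make the
      right-hand side equal to -1.\<close>
    from this[of "(b x x + 1) / (2 * b x y)"] show ?thesis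
      by (cases "b x y = 0") (auto simp: True field_simps)
  next
    case False
    then have pos: "0 < b y y"
      using nonneg[of y] by simp
    \<comment> \<open>The ratio \<open>t / s = b x y / b y y\<close> minimizes the quadratic; taking
      \<open>s = b y y\<close> avoids the division.\<close>
    have "0 \<le> b y y * (b x x * b y y - (b x y)\<^sup>2)"
      using quad[of "b y y" "b x y"] by (simp add: power2_eq_square algebra_simps)
    with pos show ?thesis
      by (simp add: zero_le_mult_iff)
  qed
qed

lemma inner_product_bilinear: "inner_product ip \<Longrightarrow> bilinear ip"
  and inner_product_commute: "inner_product ip \<Longrightarrow> ip x y = ip y x"
  and inner_product_pos: "inner_product ip \<Longrightarrow> x \<noteq> 0 \<Longrightarrow> 0 < ip x x"
  by (simp_all add: inner_product_def)

lemma inner_product_nonneg: "inner_product ip \<Longrightarrow> 0 \<le> ip x x"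
  by (cases "x = 0") (auto simp: inner_product_def bilinear_lzero less_imp_le)

lemma inner_product_ext:
  assumes ip: "inner_product ip" and eq: "\<And>y. ip u y = ip v y"
  shows "u = v"
proof -
  have "ip (u - v) (u - v) = 0"
    using eq by (simp add: bilinear_lsub[OF inner_product_bilinear[OF ip]])
  then show ?thesis
    using inner_product_pos[OF ip, of "u - v"] by force
qed

lemma ip_norm_Cauchy_Schwarz:
  assumes ip: "inner_product ip"
  shows "ip x y \<le> ip_norm ip x * ip_norm ip y"
proof -
  have "ip x y \<le> sqrt ((ip x y)\<^sup>2)"
    by simp
  also have "\<dots> \<le> sqrt (ip x x * ip y y)"
    using bilinear_semidefinite_Cauchy_Schwarz[of ip x y] ip
    by (intro real_sqrt_le_mono)
      (auto simp: inner_product_bilinear inner_product_commute inner_product_nonneg)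
  finally show ?thesis
    by (simp add: ip_norm_def real_sqrt_mult)
qed

lemma ip_norm_square: "inner_product ip \<Longrightarrow> ip_norm ip x * ip_norm ip x = ip x x"
  by (simp add: ip_norm_def inner_product_nonneg)

lemma ip_norm_nonneg: "inner_product ip \<Longrightarrow> 0 \<le> ip_norm ip x"
  by (simp add: ip_norm_def inner_product_nonneg)

section \<open>Positive self-adjoint operators\<close>

lemma bilinear_comp_linear: "bilinear b \<Longrightarrow> linear A \<Longrightarrow> bilinear (\<lambda>x y. b (A x) y)"
  unfolding bilinear_def by (auto intro: linear_compose[unfolded o_def])

text \<open>The hypothesis speaks only of eigenvalues, so one must be produced that bounds the form
  from below. Compactness of the sphere supplies a minimizer of the Rayleigh quotient, which turns
  out to be an eigenvector.\<close>

lemma positive_definite_nonneg: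
  fixes ip :: "'v::euclidean_space \<Rightarrow> 'v \<Rightarrow> real"
  assumes ip: "inner_product ip" and P: "positive_definite ip P"
  shows "0 \<le> ip (P x) x"
proof -
  note bil = inner_product_bilinear[OF ip]
  have lin: "linear P" and adj: "\<And>x y. ip (P x) y = ip x (P y)"
    using P by (auto simp: positive_definite_def self_adjoint_def)
  \<comment> \<open>The sphere used below is that of the library norm, so \<open>ip x x\<close> need
    not be 1 on it and the quotient keeps its denominator.\<close>
  define R where "R x = ip (P x) x / ip x x" for x
  interpret bb: bounded_bilinear ip
    using bil by (simp add: bilinear_conv_bounded_bilinear)
  have cont: "continuous_on (sphere 0 1) R"
  proof -
    have "continuous_on (sphere 0 1) P"
      using lin by (simp add: linear_continuous_on linear_conv_bounded_linear)
    moreover have "ip x x \<noteq> 0" if "x \<in> sphere 0 1" for x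
      using that inner_product_pos[OF ip, of x] by force
    ultimately show ?thesis
      unfolding R_def by (intro continuous_on_divide bb.continuous_on continuous_on_id) auto
  qed
  have "sphere (0::'v) 1 \<noteq> {}"
    by simp
  then obtain v where v: "norm v = 1" and least: "\<And>x. norm x = 1 \<Longrightarrow> R v \<le> R x"
    using continuous_attains_inf[OF compact_sphere _ cont] by auto
  \<comment> \<open>This is the form of \<open>P - R v\<close> times the identity. It is
    semidefinite because \<open>R v\<close> is least, and \<open>v\<close> is a null vector of
    it.\<close>
  define b where "b x y = ip (P x - R v *\<^sub>R x) y" for x y
  have b: "bilinear b"
    unfolding b_def
    by (rule bilinear_comp_linear[OF bil]) (intro linear_compose_sub lin linear_scaleR)
  have sym: "b x y = b y x" for x y
    unfolding b_def using adj[of x y] inner_product_commute[OF ip, of x "P y"]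
      inner_product_commute[OF ip, of x y]
    by (simp add: bilinear_lsub[OF bil] bilinear_lmul[OF bil])
  have nonneg: "0 \<le> b x x" for x
  proof (cases "x = 0")
    case True
    then show ?thesis
      by (simp add: bilinear_lzero[OF b])
  next
    case False
    have "R v \<le> R ((1 / norm x) *\<^sub>R x)"
      using False by (intro least) simp
    also have "\<dots> = R x"
      using False by (simp add: R_def linear_scale[OF lin] bilinear_lmul[OF bil] bilinear_rmul[OF bil])
    finally show ?thesis
      using inner_product_pos[OF ip False]
      by (simp add: b_def R_def bilinear_lsub[OF bil] bilinear_lmul[OF bil] field_simps)
  qed
  have "v \<noteq> 0"
    using v by auto
  then have "b v v = 0"
    using inner_product_pos[OF ip, of v]
    by (simp add: b_def R_def bilinear_lsub[OF bil] bilinear_lmul[OF bil])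
  \<comment> \<open>By Cauchy-Schwarz, a null vector of a semidefinite form is orthogonal to
    everything, so \<open>v\<close> lies in the kernel of the shifted operator.\<close>
  then have "b v y = 0" for y
    using bilinear_semidefinite_Cauchy_Schwarz[OF b sym nonneg, of v y] by simp
  then have "P v - R v *\<^sub>R v = 0"
    by (intro inner_product_ext[OF ip]) (simp add: b_def bilinear_lzero[OF bil])
  then have "is_eigenvalue P (R v)"
    using \<open>v \<noteq> 0\<close> by (auto simp: is_eigenvalue_def)
  then have "0 < R v"
    using P by (simp add: positive_definite_def)
  then have "0 \<le> R v * ip x x"
    using inner_product_nonneg[OF ip, of x] by simp
  also have "\<dots> \<le> ip (P x) x"
    using nonneg[of x] by (simp add: b_def bilinear_lsub[OF bil] bilinear_lmul[OF bil])
  finally show ?thesis .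
qed

text \<open>Cauchy-Schwarz for the form \<open>ip (P x) y\<close> at \<open>u\<close> and
  \<open>P u\<close> bounds the square of \<open>ip (P u) (P u)\<close> by
  \<open>ip (P u) u * ip (P (P u)) (P u)\<close>. Nonexpansiveness bounds the last factor by
  \<open>ip (P u) (P u)\<close>, which cancels when \<open>P u\<close> is nonzero.\<close>

lemma nonexpansive_positive_firmly:
  fixes ip :: "'v::real_vector \<Rightarrow> 'v \<Rightarrow> real"
  assumes ip: "inner_product ip" and P: "self_adjoint ip P" "nonexpansive ip P"
    and nonneg: "\<And>x. 0 \<le> ip (P x) x"
  shows "ip (P u) (P u) \<le> ip (P u) u"
proof (cases "P u = 0")
  case True
  then show ?thesis
    by (simp add: bilinear_lzero[OF inner_product_bilinear[OF ip]])
next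
  case False
  have lin: "linear P" and adj: "\<And>x y. ip (P x) y = ip x (P y)"
    using P(1) by (auto simp: self_adjoint_def)
  have "ip_norm ip (P (P u)) \<le> ip_norm ip (P u)"
    using P(2)[unfolded nonexpansive_def, rule_format, of "P u" 0] by (simp add: linear_0[OF lin])
  then have "ip_norm ip (P (P u)) * ip_norm ip (P u) \<le> ip_norm ip (P u) * ip_norm ip (P u)"
    by (intro mult_right_mono ip_norm_nonneg ip)
  then have PP: "ip (P (P u)) (P u) \<le> ip (P u) (P u)"
    using ip_norm_Cauchy_Schwarz[OF ip, of "P (P u)" "P u"] by (simp add: ip_norm_square[OF ip])
  have sym: "ip (P x) y = ip (P y) x" for x y
    using adj[of x y] inner_product_commute[OF ip, of x "P y"] by simp
  have "(ip (P u) (P u))\<^sup>2 \<le> ip (P u) u * ip (P (P u)) (P u)"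
    using bilinear_comp_linear[OF inner_product_bilinear[OF ip] lin] sym nonneg
    by (rule bilinear_semidefinite_Cauchy_Schwarz)
  also have "\<dots> \<le> ip (P u) u * ip (P u) (P u)"
    using PP nonneg by (rule mult_left_mono)
  finally show ?thesis
    using inner_product_pos[OF ip False] by (simp add: power2_eq_square)
qed

section \<open>Calculus of gradients\<close>

lemma has_gradient_unique:
  assumes ip: "inner_product ip" and "has_gradient ip f g x" "has_gradient ip f g' x"
  shows "g = g'"
proof (rule inner_product_ext[OF ip])
  show "ip g y = ip g' y" for y
    using has_derivative_unique assms(2,3) unfolding has_gradient_def by metis
qed

text \<open>The product rule yields two terms, which coincide by self-adjointness and absorb the
  factor 1/2.\<close>

lemma has_gradient_quadratic_form:
  fixes ip :: "'v::euclidean_space \<Rightarrow> 'v \<Rightarrow> real"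
  assumes ip: "inner_product ip" and P: "self_adjoint ip P"
  shows "has_gradient ip (\<lambda>x. 1 / 2 * ip (P x) x) (P x) x"
proof -
  interpret bb: bounded_bilinear ip
    using inner_product_bilinear[OF ip] by (simp add: bilinear_conv_bounded_bilinear)
  have lin: "bounded_linear P" and adj: "\<And>x y. ip (P x) y = ip x (P y)"
    using P by (auto simp: self_adjoint_def linear_conv_bounded_linear)
  have "((\<lambda>x. 1 / 2 * ip (P x) x) has_derivative (\<lambda>h. 1 / 2 * (ip (P x) h + ip (P h) x))) (at x)"
    by (intro has_derivative_mult_right bb.FDERIV bounded_linear_imp_has_derivative lin
        has_derivative_ident)
  moreover have "1 / 2 * (ip (P x) h + ip (P h) x) = ip (P x) h" for h
    by (simp add: adj[of h x] inner_product_commute[OF ip, of h])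
  ultimately show ?thesis
    by (simp add: has_gradient_def)
qed

lemma has_gradient_add:
  assumes "inner_product ip" "has_gradient ip f g x" "has_gradient ip f' g' x"
  shows "has_gradient ip (\<lambda>x. f x + f' x) (g + g') x"
  using has_derivative_add[of f _ "at x" f'] assms
  by (simp add: has_gradient_def bilinear_ladd[OF inner_product_bilinear])

lemma has_gradient_diff:
  assumes "inner_product ip" "has_gradient ip f g x" "has_gradient ip f' g' x"
  shows "has_gradient ip (\<lambda>x. f x - f' x) (g - g') x"
  using has_derivative_diff[of f _ "at x" f'] assms
  by (simp add: has_gradient_def bilinear_lsub[OF inner_product_bilinear])

lemma has_gradient_linear:
  fixes ip :: "'v::euclidean_space \<Rightarrow> 'v \<Rightarrow> real"
  assumes "inner_product ip"
  shows "has_gradient ip (ip q) q x"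
proof -
  have "bounded_linear (ip q)"
    using inner_product_bilinear[OF assms] by (simp add: bilinear_def linear_conv_bounded_linear)
  then show ?thesis
    by (simp add: has_gradient_def bounded_linear_imp_has_derivative)
qed

text \<open>The chain rule applies the adjoint of the linear part to \<open>g\<close>; here that
  adjoint is \<open>P\<close> itself.\<close>

lemma has_gradient_compose_affine:
  fixes ip :: "'v::euclidean_space \<Rightarrow> 'v \<Rightarrow> real"
  assumes P: "self_adjoint ip P" and f: "has_gradient ip f g (P x + q)"
  shows "has_gradient ip (\<lambda>x. f (P x + q)) (P g) x"
proof -
  have lin: "bounded_linear P" and adj: "\<And>x y. ip (P x) y = ip x (P y)"
    using P by (auto simp: self_adjoint_def linear_conv_bounded_linear)
  have "((\<lambda>x. P x + q) has_derivative P) (at x)"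
    using has_derivative_add_const[OF bounded_linear_imp_has_derivative[OF lin]] .
  from has_derivative_compose[OF this f[unfolded has_gradient_def]] show ?thesis
    by (simp add: has_gradient_def adj)
qed

section \<open>Critical points and global minimizers\<close>

lemma Argmin_has_gradient:
  fixes F :: "'v::real_normed_vector \<Rightarrow> real"
  assumes ip: "inner_product ip" and grad: "has_gradient ip F g x" and x: "x \<in> Argmin F"
  shows "g = 0"
proof -
  have "\<forall>y\<in>ball x 1. F x \<le> F y"
    using x by (auto simp: Argmin_def is_arg_min_def not_less)
  then have "(\<lambda>h. ip g h) = (\<lambda>h. 0)"
    using grad unfolding has_gradient_def
    by (intro differential_zero_maxmin[of x "ball x 1" F]) auto
  then have "ip g h = 0" for h
    by meson
  then show ?thesis
    by (intro inner_product_ext[OF ip]) (simp add: bilinear_lzero[OF inner_product_bilinear[OF ip]])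
qed

text \<open>The mean value theorem on the segment from \<open>x\<close> to \<open>y\<close>
  expresses \<open>F y - F x\<close> through the gradient at an intermediate point, and monotonicity
  compares that gradient with the vanishing one at \<open>x\<close>.\<close>

lemma monotone_gradient_zero_imp_Argmin:
  fixes F :: "'v::real_normed_vector \<Rightarrow> real"
  assumes ip: "inner_product ip" and grad: "\<And>x. has_gradient ip F (G x) x"
    and mono: "\<And>x y. 0 \<le> ip (G x - G y) (x - y)" and zero: "G x = 0"
  shows "x \<in> Argmin F"
proof -
  have "F x \<le> F y" for y
  proof -
    define u where "u = y - x"
    have "((\<lambda>t. F (x + t *\<^sub>R u)) has_real_derivative ip (G (x + t *\<^sub>R u)) u) (at t)" for t
    proof -
      have "((\<lambda>t. x + t *\<^sub>R u) has_derivative (\<lambda>h. h *\<^sub>R u)) (at t)"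
        by (auto intro!: derivative_eq_intros)
      from has_derivative_compose[OF this grad[unfolded has_gradient_def]] show ?thesis
        by (simp add: has_field_derivative_def bilinear_rmul[OF inner_product_bilinear[OF ip]]
            mult_commute_abs)
    qed
    then obtain t where t: "0 < t" "F (x + 1 *\<^sub>R u) - F (x + 0 *\<^sub>R u) = (1 - 0) * ip (G (x + t *\<^sub>R u)) u"
      using MVT2[of 0 1 "\<lambda>t. F (x + t *\<^sub>R u)" "\<lambda>t. ip (G (x + t *\<^sub>R u)) u"] by auto
    have "0 \<le> t * ip (G (x + t *\<^sub>R u)) u"
      using mono[of "x + t *\<^sub>R u" x] zero by (simp add: bilinear_rmul[OF inner_product_bilinear[OF ip]])
    with t show ?thesis
      by (simp add: u_def zero_le_mult_iff)
  qed
  then show ?thesis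
    by (auto simp: Argmin_def is_arg_min_def not_less)
qed

theorem proposition3p3:
  fixes ip :: "real ^ 'n \<Rightarrow> real ^ 'n \<Rightarrow> real"
    and P S1 S2 :: "real ^ 'n \<Rightarrow> real ^ 'n"
    and q :: "real ^ 'n"
    and f1 f2 F :: "real ^ 'n \<Rightarrow> real"
    and Xstar :: "(real ^ 'n) set"
  assumes ip: "inner_product ip"
    and P_linear: "linear P"
    and P_self_adjoint: "self_adjoint ip P"
    and P_nonexpansive: "nonexpansive ip P"
    and S2_gradient: "\<And>x. has_gradient ip f2 (S2 x) x"
    and S2_nonexpansive: "nonexpansive ip S2"
  defines "f1 \<equiv> \<lambda>x. 1 / 2 * ip (P x) x + ip q x"
    and "S1 \<equiv> \<lambda>x. P x + q"
    and "F \<equiv> \<lambda>x. 1 / 2 * ip (P x) x - f2 (S1 x)"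
    and "Xstar \<equiv> {x. has_gradient ip F 0 x}"
  shows "(\<forall>x. has_gradient ip f1 (S1 x) x) \<and>
    (bij P \<longrightarrow> Xstar = fixed_points (S2 \<circ> S1)) \<and>
    (bij P \<and> positive_definite ip P \<longrightarrow>
       Argmin F = Xstar \<and> Xstar = fixed_points (S2 \<circ> S1))"
proof -
  note bil = inner_product_bilinear[OF ip]
  define G where "G x = P (x - S2 (S1 x))" for x
  have grad_f1: "has_gradient ip f1 (S1 x) x" for x
    unfolding f1_def S1_def
    by (intro has_gradient_add has_gradient_quadratic_form has_gradient_linear ip P_self_adjoint)
  have grad_F: "has_gradient ip F (G x) x" for x
    unfolding F_def S1_def G_def linear_diff[OF P_linear]
    by (intro has_gradient_diff has_gradient_quadratic_form has_gradient_compose_affine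
        S2_gradient ip P_self_adjoint)
  \<comment> \<open>Uniqueness of gradients turns "0 is a gradient at \<open>x\<close>" into
    \<open>G x = 0\<close>.\<close>
  have Xstar: "Xstar = {x. G x = 0}"
    unfolding Xstar_def using has_gradient_unique[OF ip grad_F] grad_F by (metis (no_types))
  have fixed: "Xstar = fixed_points (S2 \<circ> S1)" if "bij P"
  proof -
    have "G x = 0 \<longleftrightarrow> S2 (S1 x) = x" for x
      using linear_injective_0[OF P_linear] bij_is_inj[OF that] linear_0[OF P_linear]
      unfolding G_def by (metis eq_iff_diff_eq_0)
    then show ?thesis
      by (simp add: Xstar fixed_points_def)
  qed
  have "Argmin F = Xstar" if P: "positive_definite ip P"
  proof -
    have "0 \<le> ip (G x - G y) (x - y)" for x y
    proof -
      define u where "u = x - y"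
      define w where "w = S2 (S1 x) - S2 (S1 y)"
      \<comment> \<open>The increment of \<open>S1\<close> is \<open>P u\<close>, so
        nonexpansiveness of \<open>S2\<close> bounds \<open>w\<close> by \<open>P u\<close>, the
        very vector that \<open>w\<close> is paired with once self-adjointness moves
        \<open>P\<close> across.\<close>
      have Pu: "S1 x - S1 y = P u"
        by (simp add: S1_def u_def linear_diff[OF P_linear])
      have "ip_norm ip w \<le> ip_norm ip (P u)"
        using S2_nonexpansive by (simp add: nonexpansive_def w_def flip: Pu)
      then have "ip_norm ip w * ip_norm ip (P u) \<le> ip_norm ip (P u) * ip_norm ip (P u)"
        by (intro mult_right_mono ip_norm_nonneg ip)
      then have "ip w (P u) \<le> ip (P u) (P u)"
        using ip_norm_Cauchy_Schwarz[OF ip, of w "P u"] by (simp add: ip_norm_square[OF ip])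
      also have "\<dots> \<le> ip (P u) u"
        using nonexpansive_positive_firmly ip P_self_adjoint P_nonexpansive
          positive_definite_nonneg[OF ip P] by blast
      finally have "ip (P w) u \<le> ip (P u) u"
        using P_self_adjoint by (simp add: self_adjoint_def)
      moreover have "G x - G y = P u - P w"
        by (simp add: G_def u_def w_def linear_diff[OF P_linear])
      ultimately show ?thesis
        by (simp add: bilinear_lsub[OF bil] flip: u_def)
    qed
    then show ?thesis
      unfolding Xstar
      using Argmin_has_gradient[OF ip grad_F] monotone_gradient_zero_imp_Argmin[OF ip grad_F] by blast
  qed
  with grad_f1 fixed show ?thesis
    by blast
qed

end
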